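(* The Schreier space $X$ does not have the uniform $\lambda$-property; that is, there is no $\lambda_0>0$ such that $\lambda(x)\geqslant\lambda_0$ for all $x\in Ba(X)$.
   Context: Schreier space: let $c_{00}$ be the vector space of finitely supported real sequences $x=(x(1),x(2),\ldots)$. A set $F\subset\mathbb{N}=\{1,2,\ldots\}$ is admissible if $\min F\geqslant |F|$, and $\mathcal{S}_1$ denotes the collection of all admissible subsets of $\mathbb{N}$. The Schreier space $X$ is the completion of $c_{00}$ with respect to the norm $\|x\|=\sup_{F\in\mathcal{S}_1}\sum_{i\in F}|x(i)|$. For a Banach space $Y$, $Ba(Y)$, $S(Y)$ and $E(Y)$ denote the closed unit ball, the unit sphere and the set of extreme points of the unit ball of $Y$. For $y\in Ba(Y)$, write $(e,z,\lambda)\sim y$ if $e\in E(Y)$, $z\in Ba(Y)$, $0<\lambda\leqslant 1$ and $y=\lambda e+(1-\lambda)z$. $Y$ has the $\lambda$-property if every $y\in Ba(Y)$ admits such a triple. The $\lambda$-function is $\lambda(y)=\sup\{\lambda:(e,z,\lambda)\sim y\}$. $Y$ has the uniform $\lambda$-property if there exists $\lambda_0>0$ such that $\lambda(y)\geqslant\lambda_0$ for all $y\in Ba(Y)$. *)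

theory Defs
  imports "HOL-Analysis.Analysis"
begin

section \<open>The Schreier space\<close>

text \<open>Sequences \<open>x = (x(1), x(2), \<dots>)\<close> are functions \<^typ>\<open>nat \<Rightarrow> real\<close> whose value at the
  unused index \<open>0\<close> is \<open>0\<close>.\<close>

definition c00 :: "(nat \<Rightarrow> real) set" where
  "c00 = {x. x 0 = 0 \<and> finite {i. x i \<noteq> 0}}"

text \<open>The empty set is admissible by convention; it contributes \<open>0\<close> to the norm.\<close>

definition admissible :: "nat set \<Rightarrow> bool" where
  "admissible F \<longleftrightarrow> F \<subseteq> {1..} \<and> finite F \<and> (F \<noteq> {} \<longrightarrow> Min F \<ge> card F)"

definition schreier_norm :: "(nat \<Rightarrow> real) \<Rightarrow> real" where
  "schreier_norm x = (SUP F\<in>{F. admissible F}. \<Sum>i\<in>F. \<bar>x i\<bar>)"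

definition finite_schreier_norm :: "(nat \<Rightarrow> real) \<Rightarrow> bool" where
  "finite_schreier_norm x \<longleftrightarrow> bdd_above ((\<lambda>F. \<Sum>i\<in>F. \<bar>x i\<bar>) ` {F. admissible F})"

lemma admissible_empty [simp]: "admissible {}"
  by (simp add: admissible_def)

lemma admissible_singleton: "i \<ge> 1 \<Longrightarrow> admissible {i}"
  by (simp add: admissible_def)

lemma sum_le_schreier_norm:
  "finite_schreier_norm x \<Longrightarrow> admissible F \<Longrightarrow> (\<Sum>i\<in>F. \<bar>x i\<bar>) \<le> schreier_norm x"
  unfolding schreier_norm_def finite_schreier_norm_def by (rule cSUP_upper) auto

lemma schreier_norm_le:
  "(\<And>F. admissible F \<Longrightarrow> (\<Sum>i\<in>F. \<bar>x i\<bar>) \<le> c) \<Longrightarrow> schreier_norm x \<le> c"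
  unfolding schreier_norm_def by (rule cSUP_least) (auto intro: admissible_empty)

lemma finite_schreier_normI:
  "(\<And>F. admissible F \<Longrightarrow> (\<Sum>i\<in>F. \<bar>x i\<bar>) \<le> c) \<Longrightarrow> finite_schreier_norm x"
  unfolding finite_schreier_norm_def by (rule bdd_aboveI2[where M = c]) auto

lemma schreier_norm_nonneg: "finite_schreier_norm x \<Longrightarrow> 0 \<le> schreier_norm x"
  using sum_le_schreier_norm[of x "{}"] by simp

lemma abs_le_schreier_norm:
  "finite_schreier_norm x \<Longrightarrow> i \<ge> 1 \<Longrightarrow> \<bar>x i\<bar> \<le> schreier_norm x"
  using sum_le_schreier_norm[of x "{i}"] admissible_singleton[of i] by simp

lemma schreier_norm_add:
  assumes "finite_schreier_norm x" "finite_schreier_norm y"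
  shows "finite_schreier_norm (\<lambda>i. x i + y i)"
    and "schreier_norm (\<lambda>i. x i + y i) \<le> schreier_norm x + schreier_norm y"
proof -
  have *: "(\<Sum>i\<in>F. \<bar>x i + y i\<bar>) \<le> schreier_norm x + schreier_norm y" if "admissible F" for F
  proof -
    have "(\<Sum>i\<in>F. \<bar>x i + y i\<bar>) \<le> (\<Sum>i\<in>F. \<bar>x i\<bar> + \<bar>y i\<bar>)"
      by (intro sum_mono abs_triangle_ineq)
    then show ?thesis
      using sum_le_schreier_norm[OF assms(1) that] sum_le_schreier_norm[OF assms(2) that]
      by (simp add: sum.distrib)
  qed
  show "finite_schreier_norm (\<lambda>i. x i + y i)"
    by (rule finite_schreier_normI) (rule *)
  show "schreier_norm (\<lambda>i. x i + y i) \<le> schreier_norm x + schreier_norm y"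
    by (rule schreier_norm_le) (rule *)
qed

lemma schreier_norm_scale:
  assumes "finite_schreier_norm x"
  shows "finite_schreier_norm (\<lambda>i. r * x i)"
    and "schreier_norm (\<lambda>i. r * x i) = \<bar>r\<bar> * schreier_norm x"
proof -
  have *: "finite_schreier_norm (\<lambda>i. r * x i) \<and> schreier_norm (\<lambda>i. r * x i) \<le> \<bar>r\<bar> * schreier_norm x"
    if "finite_schreier_norm x" for r x
  proof -
    have "(\<Sum>i\<in>F. \<bar>r * x i\<bar>) \<le> \<bar>r\<bar> * schreier_norm x" if F: "admissible F" for F
      using mult_left_mono[OF sum_le_schreier_norm[OF \<open>finite_schreier_norm x\<close> F], of "\<bar>r\<bar>"]
      by (simp add: abs_mult sum_distrib_left)
    then show ?thesis
      by (intro conjI finite_schreier_normI[of _ "\<bar>r\<bar> * schreier_norm x"] schreier_norm_le)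
  qed
  show fin: "finite_schreier_norm (\<lambda>i. r * x i)" using *[OF assms] by blast
  show "schreier_norm (\<lambda>i. r * x i) = \<bar>r\<bar> * schreier_norm x"
  proof (cases "r = 0")
    case True
    have "schreier_norm (\<lambda>i. r * x i) \<le> 0"
      using *[OF assms, of r] True by simp
    then show ?thesis using schreier_norm_nonneg[OF fin] True by simp
  next
    case False
    have "schreier_norm x \<le> \<bar>inverse r\<bar> * schreier_norm (\<lambda>i. r * x i)"
      using *[OF fin, of "inverse r"] False by (simp add: mult.assoc[symmetric])
    then have "\<bar>r\<bar> * schreier_norm x \<le> schreier_norm (\<lambda>i. r * x i)"
      using False by (simp add: abs_inverse field_simps)
    then show ?thesis using *[OF assms, of r] by simp
  qed
qed

lemma schreier_norm_diff:
  assumes "finite_schreier_norm x" "finite_schreier_norm y"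
  shows "finite_schreier_norm (\<lambda>i. x i - y i)"
    and "schreier_norm (\<lambda>i. x i - y i) \<le> schreier_norm x + schreier_norm y"
  using schreier_norm_add[OF assms(1) schreier_norm_scale(1)[OF assms(2), of "-1"]]
    schreier_norm_scale(2)[OF assms(2), of "-1"] by simp_all

lemma c00_finite_norm:
  assumes "x \<in> c00" shows "finite_schreier_norm x"
proof (rule finite_schreier_normI)
  fix F assume "admissible F"
  then have "finite F" by (simp add: admissible_def)
  have fin: "finite {i. x i \<noteq> 0}" using assms by (simp add: c00_def)
  have "(\<Sum>i\<in>F. \<bar>x i\<bar>) = (\<Sum>i\<in>F \<inter> {i. x i \<noteq> 0}. \<bar>x i\<bar>)"
    by (rule sum.mono_neutral_right) (use \<open>finite F\<close> in auto)
  also have "\<dots> \<le> (\<Sum>i | x i \<noteq> 0. \<bar>x i\<bar>)"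
    by (rule sum_mono2) (use fin in auto)
  finally show "(\<Sum>i\<in>F. \<bar>x i\<bar>) \<le> (\<Sum>i | x i \<noteq> 0. \<bar>x i\<bar>)" .
qed

lemma c00_zero: "(\<lambda>i. 0) \<in> c00"
  by (simp add: c00_def)

lemma c00_add: "x \<in> c00 \<Longrightarrow> y \<in> c00 \<Longrightarrow> (\<lambda>i. x i + y i) \<in> c00"
  unfolding c00_def
  by (auto intro: finite_subset[where B = "{i. x i \<noteq> 0} \<union> {i. y i \<noteq> 0}"])

lemma c00_scale: "x \<in> c00 \<Longrightarrow> (\<lambda>i. r * x i) \<in> c00"
  unfolding c00_def by (auto intro: finite_subset[where B = "{i. x i \<noteq> 0}"])

text \<open>The completion of \<open>c00\<close> is realised as the closure of \<open>c00\<close> inside the space of all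
  sequences with finite Schreier norm. The instance \<open>schreier :: banach\<close> and the lemmas
  \<open>coord_add\<close>, \<open>coord_scaleR\<close>, \<open>norm_schreier_def\<close>, \<open>c00_subset_range_coord\<close> and
  \<open>c00_dense\<close> below show that this is a Banach space containing \<open>c00\<close>, with the norm above, as a
  dense subspace.\<close>

definition schreier_seqs :: "(nat \<Rightarrow> real) set" where
  "schreier_seqs = {x. x 0 = 0 \<and> finite_schreier_norm x \<and>
     (\<forall>\<epsilon>>0. \<exists>y\<in>c00. schreier_norm (\<lambda>i. x i - y i) < \<epsilon>)}"

lemma c00_subset_schreier_seqs: "c00 \<subseteq> schreier_seqs"
proof
  fix x assume x: "x \<in> c00"
  have "schreier_norm (\<lambda>i. x i - x i) \<le> 0" by (rule schreier_norm_le) simp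
  then show "x \<in> schreier_seqs"
    using x c00_finite_norm[OF x] unfolding schreier_seqs_def
    by (auto simp: c00_def intro!: bexI[of _ x])
qed

typedef schreier = schreier_seqs
  morphisms coord Abs_schreier
  using c00_subset_schreier_seqs c00_zero by auto

lemma coord_finite_norm: "finite_schreier_norm (coord a)"
  using coord[of a] by (simp add: schreier_seqs_def)

lemma coord_0 [simp]: "coord a 0 = 0"
  using coord[of a] by (simp add: schreier_seqs_def)

lemma coord_approx: "\<epsilon> > 0 \<Longrightarrow> \<exists>y\<in>c00. schreier_norm (\<lambda>i. coord a i - y i) < \<epsilon>"
  using coord[of a] by (simp add: schreier_seqs_def)

lemma schreier_seqs_add:
  assumes x: "x \<in> schreier_seqs" and y: "y \<in> schreier_seqs"
  shows "(\<lambda>i. x i + y i) \<in> schreier_seqs"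
proof -
  have fin: "finite_schreier_norm x" "finite_schreier_norm y"
    using x y by (auto simp: schreier_seqs_def)
  have "\<exists>w\<in>c00. schreier_norm (\<lambda>i. x i + y i - w i) < \<epsilon>" if "\<epsilon> > 0" for \<epsilon> :: real
  proof -
    have "\<epsilon>/2 > 0" using that by simp
    then obtain u v where u: "u \<in> c00" "schreier_norm (\<lambda>i. x i - u i) < \<epsilon>/2"
      and v: "v \<in> c00" "schreier_norm (\<lambda>i. y i - v i) < \<epsilon>/2"
      using x y unfolding schreier_seqs_def by blast
    have "schreier_norm (\<lambda>i. (x i - u i) + (y i - v i)) < \<epsilon>"
      using schreier_norm_add(2)[OF schreier_norm_diff(1)[OF fin(1) c00_finite_norm[OF u(1)]]
          schreier_norm_diff(1)[OF fin(2) c00_finite_norm[OF v(1)]]] u(2) v(2) by simp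
    then show ?thesis
      using c00_add[OF u(1) v(1)]
      by (intro bexI[of _ "\<lambda>i. u i + v i"]) (simp_all add: algebra_simps)
  qed
  then show ?thesis
    using x y schreier_norm_add(1)[OF fin] by (auto simp: schreier_seqs_def)
qed

lemma schreier_seqs_scale:
  assumes x: "x \<in> schreier_seqs"
  shows "(\<lambda>i. r * x i) \<in> schreier_seqs"
proof -
  have fin: "finite_schreier_norm x" using x by (auto simp: schreier_seqs_def)
  have "\<exists>w\<in>c00. schreier_norm (\<lambda>i. r * x i - w i) < \<epsilon>" if "\<epsilon> > 0" for \<epsilon> :: real
  proof -
    have "\<epsilon> / (\<bar>r\<bar> + 1) > 0" using that by simp
    then obtain u where u: "u \<in> c00" "schreier_norm (\<lambda>i. x i - u i) < \<epsilon> / (\<bar>r\<bar> + 1)"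
      using x unfolding schreier_seqs_def by blast
    have fd: "finite_schreier_norm (\<lambda>i. x i - u i)"
      by (rule schreier_norm_diff(1)[OF fin c00_finite_norm[OF u(1)]])
    have "(\<bar>r\<bar> + 1) * schreier_norm (\<lambda>i. x i - u i) < \<epsilon>"
      using u(2) by (simp add: pos_less_divide_eq mult.commute)
    then have "\<bar>r\<bar> * schreier_norm (\<lambda>i. x i - u i) < \<epsilon>"
      using schreier_norm_nonneg[OF fd] by (simp add: algebra_simps)
    then have "schreier_norm (\<lambda>i. r * (x i - u i)) < \<epsilon>"
      using schreier_norm_scale(2)[OF fd] by simp
    then show ?thesis
      using c00_scale[OF u(1), of r]
      by (intro bexI[of _ "\<lambda>i. r * u i"]) (simp_all add: algebra_simps)
  qed
  then show ?thesis
    using x schreier_norm_scale(1)[OF fin] by (auto simp: schreier_seqs_def)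
qed

instantiation schreier :: real_normed_vector
begin

definition zero_schreier :: schreier where
  "0 = Abs_schreier (\<lambda>i. 0)"

definition plus_schreier :: "schreier \<Rightarrow> schreier \<Rightarrow> schreier" where
  "a + b = Abs_schreier (\<lambda>i. coord a i + coord b i)"

definition scaleR_schreier :: "real \<Rightarrow> schreier \<Rightarrow> schreier" where
  "r *\<^sub>R a = Abs_schreier (\<lambda>i. r * coord a i)"

definition uminus_schreier :: "schreier \<Rightarrow> schreier" where
  "- a = (-1) *\<^sub>R (a :: schreier)"

definition minus_schreier :: "schreier \<Rightarrow> schreier \<Rightarrow> schreier" where
  "a - b = a + (- b :: schreier)"

definition norm_schreier :: "schreier \<Rightarrow> real" where
  "norm a = schreier_norm (coord a)"

definition dist_schreier :: "schreier \<Rightarrow> schreier \<Rightarrow> real" where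
  "dist a b = norm (a - b :: schreier)"

definition sgn_schreier :: "schreier \<Rightarrow> schreier" where
  "sgn a = inverse (norm a) *\<^sub>R (a :: schreier)"

definition uniformity_schreier :: "(schreier \<times> schreier) filter" where
  "uniformity_schreier = (INF e\<in>{0<..}. principal {(x, y). dist x y < e})"

definition open_schreier :: "schreier set \<Rightarrow> bool" where
  "open_schreier S \<longleftrightarrow> (\<forall>x\<in>S. \<forall>\<^sub>F (x', y) in uniformity. x' = x \<longrightarrow> y \<in> S)"

lemma coord_zero: "coord 0 = (\<lambda>i. 0)"
  unfolding zero_schreier_def
  by (rule Abs_schreier_inverse) (use c00_subset_schreier_seqs c00_zero in auto)

lemma coord_add: "coord (a + b) = (\<lambda>i. coord a i + coord b i)"
  unfolding plus_schreier_def by (intro Abs_schreier_inverse schreier_seqs_add coord)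

lemma coord_scaleR: "coord (r *\<^sub>R a) = (\<lambda>i. r * coord a i)"
  unfolding scaleR_schreier_def by (intro Abs_schreier_inverse schreier_seqs_scale coord)

lemma coord_uminus: "coord (- a) = (\<lambda>i. - coord a i)"
  by (simp add: uminus_schreier_def coord_scaleR)

lemma coord_minus: "coord (a - b) = (\<lambda>i. coord a i - coord b i)"
  by (simp add: minus_schreier_def coord_add coord_uminus)

instance
proof
  note cs = coord_inject[symmetric] fun_eq_iff coord_zero coord_add coord_scaleR
    coord_uminus coord_minus
  fix a b c :: schreier and r s :: real
  show "a + b + c = a + (b + c)" "a + b = b + a" "0 + a = a" "- a + a = 0" "a - b = a + - b"
    by (simp_all add: cs)
  show "r *\<^sub>R (a + b) = r *\<^sub>R a + r *\<^sub>R b" "(r + s) *\<^sub>R a = r *\<^sub>R a + s *\<^sub>R a"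
    "r *\<^sub>R s *\<^sub>R a = (r * s) *\<^sub>R a" "1 *\<^sub>R a = a"
    by (simp_all add: cs algebra_simps)
  show "sgn a = inverse (norm a) *\<^sub>R a" by (simp add: sgn_schreier_def)
  show "dist a b = norm (a - b)" by (simp add: dist_schreier_def)
  show "uniformity = (INF e\<in>{0<..}. principal {(x, y). dist x (y::schreier) < e})"
    by (simp add: uniformity_schreier_def)
  show "open U \<longleftrightarrow> (\<forall>x\<in>U. \<forall>\<^sub>F (x', y) in uniformity. x' = x \<longrightarrow> y \<in> U)" for U :: "schreier set"
    by (simp add: open_schreier_def)
  show "norm (a + b) \<le> norm a + norm b"
    using schreier_norm_add(2)[OF coord_finite_norm coord_finite_norm]
    by (simp add: norm_schreier_def coord_add)
  show "norm (r *\<^sub>R a) = \<bar>r\<bar> * norm a"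
    using schreier_norm_scale(2)[OF coord_finite_norm]
    by (simp add: norm_schreier_def coord_scaleR)
  show "norm a = 0 \<longleftrightarrow> a = 0"
  proof
    assume "norm a = 0"
    then have "coord a i = 0" for i
      using abs_le_schreier_norm[OF coord_finite_norm, of i a]
      by (cases "i = 0") (simp_all add: norm_schreier_def)
    then show "a = 0" by (simp add: cs)
  next
    assume "a = 0"
    have "schreier_norm (\<lambda>i. 0) \<le> 0" by (rule schreier_norm_le) simp
    then show "norm a = 0"
      using \<open>a = 0\<close> schreier_norm_nonneg[OF coord_finite_norm, of a]
      by (simp add: norm_schreier_def coord_zero)
  qed
qed

end

lemma abs_coord_le_norm: "\<bar>coord a i\<bar> \<le> norm a"
  using abs_le_schreier_norm[OF coord_finite_norm, of i a]
    schreier_norm_nonneg[OF coord_finite_norm, of a]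
  by (cases "i = 0") (simp_all add: norm_schreier_def)

instance schreier :: banach
proof
  fix X :: "nat \<Rightarrow> schreier" assume "Cauchy X"
  have "\<exists>l. (\<lambda>n. coord (X n) i) \<longlonglongrightarrow> l" for i
  proof -
    have "Cauchy (\<lambda>n. coord (X n) i)"
    proof (rule metric_CauchyI)
      fix e :: real assume "e > 0"
      then obtain M where "\<forall>m\<ge>M. \<forall>n\<ge>M. norm (X m - X n) < e"
        using CauchyD[OF \<open>Cauchy X\<close>] by blast
      then show "\<exists>M. \<forall>m\<ge>M. \<forall>n\<ge>M. dist (coord (X m) i) (coord (X n) i) < e"
        using le_less_trans[OF abs_coord_le_norm[of "X _ - X _" i]]
        by (simp add: dist_real_def coord_minus) blast
    qed
    then show ?thesis by (simp add: Cauchy_convergent_iff convergent_def)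
  qed
  then obtain x where x: "\<And>i. (\<lambda>n. coord (X n) i) \<longlonglongrightarrow> x i" by metis
  have tail: "\<exists>M. \<forall>n\<ge>M. \<forall>F. admissible F \<longrightarrow> (\<Sum>i\<in>F. \<bar>x i - coord (X n) i\<bar>) \<le> e"
    if "e > 0" for e
  proof -
    obtain M where M: "\<And>m n. m \<ge> M \<Longrightarrow> n \<ge> M \<Longrightarrow> norm (X m - X n) < e"
      using CauchyD[OF \<open>Cauchy X\<close> \<open>e > 0\<close>] by blast
    have "(\<Sum>i\<in>F. \<bar>x i - coord (X n) i\<bar>) \<le> e" if n: "n \<ge> M" and F: "admissible F" for n F
    proof (rule LIMSEQ_le_const2)
      show "(\<lambda>m. \<Sum>i\<in>F. \<bar>coord (X m) i - coord (X n) i\<bar>) \<longlonglongrightarrow> (\<Sum>i\<in>F. \<bar>x i - coord (X n) i\<bar>)"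
        by (intro tendsto_intros x)
      have "(\<Sum>i\<in>F. \<bar>coord (X m) i - coord (X n) i\<bar>) \<le> e" if "m \<ge> M" for m
        using sum_le_schreier_norm[OF coord_finite_norm[of "X m - X n"] F] M[OF that n]
        by (simp add: norm_schreier_def coord_minus)
      then show "\<exists>N. \<forall>m\<ge>N. (\<Sum>i\<in>F. \<bar>coord (X m) i - coord (X n) i\<bar>) \<le> e" by blast
    qed
    then show ?thesis by blast
  qed
  have fin: "finite_schreier_norm x"
  proof -
    obtain M where "\<forall>F. admissible F \<longrightarrow> (\<Sum>i\<in>F. \<bar>x i - coord (X M) i\<bar>) \<le> 1"
      using tail[of 1] by auto
    then have "finite_schreier_norm (\<lambda>i. x i - coord (X M) i)"
      by (intro finite_schreier_normI) auto
    from schreier_norm_add(1)[OF this coord_finite_norm[of "X M"]] show ?thesis by simp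
  qed
  have x0: "x 0 = 0"
    using x[of 0] by (simp add: LIMSEQ_const_iff)
  have "\<exists>y\<in>c00. schreier_norm (\<lambda>i. x i - y i) < e" if "e > 0" for e
  proof -
    have "e/2 > 0" using that by simp
    from tail[OF this] obtain M
      where M: "\<And>F. admissible F \<Longrightarrow> (\<Sum>i\<in>F. \<bar>x i - coord (X M) i\<bar>) \<le> e/2" by blast
    obtain y where y: "y \<in> c00" "schreier_norm (\<lambda>i. coord (X M) i - y i) < e/2"
      using coord_approx[OF \<open>e/2 > 0\<close>] by blast
    have "schreier_norm (\<lambda>i. (x i - coord (X M) i) + (coord (X M) i - y i)) < e"
      using schreier_norm_add(2)[OF schreier_norm_diff(1)[OF fin coord_finite_norm[of "X M"]]
          schreier_norm_diff(1)[OF coord_finite_norm[of "X M"] c00_finite_norm[OF y(1)]]]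
        schreier_norm_le[OF M] y(2) by simp
    then show ?thesis using y(1) by auto
  qed
  then have "x \<in> schreier_seqs" using fin x0 by (simp add: schreier_seqs_def)
  then have cx: "coord (Abs_schreier x) = x" by (rule Abs_schreier_inverse)
  have "X \<longlonglongrightarrow> Abs_schreier x"
  proof (rule LIMSEQ_I)
    fix e :: real assume "e > 0"
    then have "e/2 > 0" by simp
    from tail[OF this] obtain M
      where M: "\<And>n F. n \<ge> M \<Longrightarrow> admissible F \<Longrightarrow> (\<Sum>i\<in>F. \<bar>x i - coord (X n) i\<bar>) \<le> e/2" by blast
    have "norm (X n - Abs_schreier x) \<le> e/2" if "n \<ge> M" for n
      unfolding norm_schreier_def coord_minus cx
      by (rule schreier_norm_le) (use M[OF that] in \<open>simp add: abs_minus_commute\<close>)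
    then show "\<exists>M. \<forall>n\<ge>M. norm (X n - Abs_schreier x) < e"
      using \<open>e > 0\<close> by (intro exI[of _ M]) fastforce
  qed
  then show "convergent X" by (auto simp: convergent_def)
qed

lemma c00_subset_range_coord: "c00 \<subseteq> range coord"
  using c00_subset_schreier_seqs type_definition.Rep_range[OF type_definition_schreier] by simp

lemma c00_dense: "closure {a. coord a \<in> c00} = UNIV"
proof -
  have "\<exists>b\<in>{a. coord a \<in> c00}. dist b a < e" if e: "e > 0" for a e
  proof -
    obtain y where y: "y \<in> c00" "schreier_norm (\<lambda>i. coord a i - y i) < e"
      using coord_approx[OF e] by blast
    then obtain b where "coord b = y" using c00_subset_range_coord by blast
    then have "coord b \<in> c00" "dist a b < e"
      using y by (simp_all add: dist_norm norm_schreier_def coord_minus)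
    then show ?thesis by (auto simp: dist_commute)
  qed
  then show ?thesis by (auto simp: closure_approachable)
qed

section \<open>The uniform lambda-property\<close>

abbreviation Ba :: "'a::real_normed_vector set" where
  "Ba \<equiv> cball 0 1"

definition lambda_triple :: "'a::real_normed_vector \<Rightarrow> 'a \<Rightarrow> real \<Rightarrow> 'a \<Rightarrow> bool" where
  "lambda_triple e z l y \<longleftrightarrow>
     e extreme_point_of Ba \<and> z \<in> Ba \<and> 0 < l \<and> l \<le> 1 \<and> y = l *\<^sub>R e + (1 - l) *\<^sub>R z"

text \<open>Inserting \<open>0\<close> makes the supremum of the empty set \<open>0\<close> (it is unspecified on the reals); by
  \<open>lambda_fun_eq\<close> it has no effect when some triple exists.\<close>

definition lambda_fun :: "'a::real_normed_vector \<Rightarrow> real" where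
  "lambda_fun y = Sup (insert 0 {l. \<exists>e z. lambda_triple e z l y})"

lemma lambda_fun_eq:
  assumes "\<exists>e z l. lambda_triple e z l y"
  shows "lambda_fun y = Sup {l. \<exists>e z. lambda_triple e z l y}"
proof -
  let ?S = "{l. \<exists>e z. lambda_triple e z l y}"
  have ne: "?S \<noteq> {}" and bdd: "bdd_above ?S" and pos: "\<And>l. l \<in> ?S \<Longrightarrow> 0 < l"
    using assms by (auto simp: lambda_triple_def intro!: bdd_aboveI[where M = 1])
  obtain l where "l \<in> ?S" using ne by blast
  then have "0 \<le> Sup ?S"
    using cSup_upper[OF _ bdd] pos by (meson less_eq_real_def order_trans)
  then show ?thesis
    unfolding lambda_fun_def using cSup_insert[OF ne bdd] by (simp add: sup_real_def)
qed

definition uniform_lambda_property :: "'a::banach itself \<Rightarrow> bool" where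
  "uniform_lambda_property _ \<longleftrightarrow>
     (\<exists>l0>0. \<forall>y\<in>(Ba :: 'a set). lambda_fun y \<ge> l0)"

end

theory Submission
  imports Defs
begin

text \<open>Whenever \<open>u = \<lambda>e + (1 - \<lambda>)z\<close>, every admissible set norming \<open>u\<close> also norms \<open>e\<close> and \<open>z\<close>.
  For each \<open>N\<close> there is a unit vector \<open>u\<close> whose norming sets force \<open>e\<close> to equal \<open>1/(2N) - g\<close> on a
  block \<open>B\<close> of \<open>2N - 2\<close> coordinates, where \<open>g \<ge> 0\<close> is a vector with a prescribed sum \<open>\<epsilon>\<close>.
  No norming set of \<open>e\<close> separates two coordinates of \<open>B\<close> at which \<open>g > 0\<close>, so mass can be moved
  between them in both directions. Thus the face looks like a simplex in the \<open>g\<close>-coordinates: an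
  extreme \<open>e\<close> has \<open>g = \<epsilon>\<close> at a single coordinate, and since \<open>u\<close> is the barycentre,
  \<open>\<lambda> \<le> 1/(2N - 2)\<close>.\<close>

section \<open>Admissible sets and sums over them\<close>

lemma admissibleI:
  assumes "finite F" "F \<subseteq> {m..}" "card F \<le> m" "1 \<le> m"
  shows "admissible F"
proof (cases "F = {}")
  case False
  then have "Min F \<in> F" using assms(1) by simp
  then have "m \<le> Min F" using assms(2) by auto
  then show ?thesis using assms by (auto simp: admissible_def)
qed simp

lemma admissibleE:
  assumes "admissible F" "F \<noteq> {}"
  obtains m where "m \<in> F" "F \<subseteq> {m..}" "card F \<le> m" "1 \<le> m"
proof
  have F: "finite F" "F \<subseteq> {1..}" "card F \<le> Min F"
    using assms by (auto simp: admissible_def)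
  show "Min F \<in> F" using F(1) assms(2) by simp
  then show "1 \<le> Min F" using F(2) by auto
  show "F \<subseteq> {Min F..}" using F(1) by auto
  show "card F \<le> Min F" by fact
qed

lemma admissible_finite: "admissible F \<Longrightarrow> finite F"
  by (simp add: admissible_def)

lemma sum_abs_coord_le:
  assumes "norm v \<le> 1" "admissible F"
  shows "(\<Sum>i\<in>F. \<bar>coord v i\<bar>) \<le> 1"
  using sum_le_schreier_norm[OF coord_finite_norm[of v] assms(2)] assms(1)
  by (simp add: norm_schreier_def)

section \<open>The face cut out by norming sets, and perturbation of extreme points\<close>

text \<open>Signed sums keep the condition linear; for nonnegative \<open>y\<close> of norm 1 the
  sets with \<open>sum y F = 1\<close> are exactly the norming ones.\<close>

definition norming_face :: "(nat \<Rightarrow> real) \<Rightarrow> schreier set" where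
  "norming_face y = {v. norm v \<le> 1 \<and>
     (\<forall>F. admissible F \<longrightarrow> sum y F = 1 \<longrightarrow> sum (coord v) F = 1)}"

lemma norming_face_sum:
  "v \<in> norming_face y \<Longrightarrow> admissible F \<Longrightarrow> sum y F = 1 \<Longrightarrow> sum (coord v) F = 1"
  by (simp add: norming_face_def)

lemma norming_face_abs_le:
  "v \<in> norming_face y \<Longrightarrow> admissible F \<Longrightarrow> (\<Sum>i\<in>F. \<bar>coord v i\<bar>) \<le> 1"
  by (rule sum_abs_coord_le) (simp_all add: norming_face_def)

text \<open>The signed sum over \<open>F\<close> is 1 while the absolute sum is at most 1, which
  leaves no room for a negative entry.\<close>

lemma norming_face_nonneg:
  assumes v: "v \<in> norming_face y" and F: "admissible F" "sum y F = 1" and i: "i \<in> F"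
  shows "0 \<le> coord v i"
proof -
  let ?d = "\<lambda>j. \<bar>coord v j\<bar> - coord v j"
  have "?d i \<le> sum ?d F"
    by (rule member_le_sum) (use i admissible_finite[OF F(1)] in auto)
  also have "\<dots> \<le> 0"
    using norming_face_sum[OF v F] norming_face_abs_le[OF v F(1)] by (simp add: sum_subtractf)
  finally show ?thesis by simp
qed

text \<open>A weighted mean of two numbers at most 1 equals 1 only if each number with positive
  weight does; for \<open>l = 1\<close> nothing is known about \<open>z\<close>.\<close>

lemma lambda_triple_norming_face:
  assumes t: "lambda_triple e z l u"
  shows "e \<in> norming_face (coord u)" and "l < 1 \<Longrightarrow> z \<in> norming_face (coord u)"
proof -
  have n: "norm e \<le> 1" "norm z \<le> 1" and l: "0 < l" "l \<le> 1"
    using t by (auto simp: lambda_triple_def extreme_point_of_def)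
  have *: "sum (coord e) F = 1 \<and> (l < 1 \<longrightarrow> sum (coord z) F = 1)"
    if F: "admissible F" and s: "sum (coord u) F = 1" for F
  proof -
    have le: "sum (coord v) F \<le> 1" if "norm v \<le> 1" for v
      using sum_mono[of F "coord v" "\<lambda>i. \<bar>coord v i\<bar>"] sum_abs_coord_le[OF that F] abs_ge_self
      by (meson order_trans)
    have eq: "l * sum (coord e) F + (1 - l) * sum (coord z) F = 1"
      using s t by (simp add: lambda_triple_def coord_add coord_scaleR sum.distrib sum_distrib_left)
    have "l * sum (coord e) F \<le> l" "(1 - l) * sum (coord z) F \<le> 1 - l"
      using mult_left_mono[OF le[OF n(1)], of l] mult_left_mono[OF le[OF n(2)], of "1 - l"] l
      by simp_all
    then have "l * sum (coord e) F = l" "(1 - l) * sum (coord z) F = 1 - l"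
      using eq by linarith+
    then show ?thesis using l by auto
  qed
  show "e \<in> norming_face (coord u)" "l < 1 \<Longrightarrow> z \<in> norming_face (coord u)"
    using * n by (auto simp: norming_face_def)
qed

lemma extreme_point_perturb:
  fixes e d :: "'a::real_normed_vector"
  assumes "e extreme_point_of Ba" "norm (e + d) \<le> 1" "norm (e - d) \<le> 1"
  shows "d = 0"
proof (rule ccontr)
  assume "d \<noteq> 0"
  then have ne: "e + d \<noteq> e - d"
    by (metis add_right_imp_eq diff_conv_add_uminus add_left_imp_eq eq_neg_iff_add_eq_0 scaleR_2
        scaleR_eq_0_iff zero_neq_numeral)
  have "e = midpoint (e + d) (e - d)"
    by (simp add: midpoint_def scaleR_2[symmetric])
  then have "e \<in> open_segment (e + d) (e - d)"
    using ne midpoint_in_open_segment by metis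
  then show False
    using assms by (auto simp: extreme_point_of_def)
qed

section \<open>The vector \<open>y\<close> and its parameters\<close>

locale slow_vector =
  fixes N :: nat
  assumes N: "3 \<le> N"
begin

text \<open>The size makes \<open>4 * N\<close> coordinates of height \<open>\<epsilon>\<close>
  weigh only \<open>r / 4\<close>, and puts \<open>{a<..2 * a}\<close> beyond
  \<open>4 * N\<close>.\<close>

definition a :: nat where "a = 16 * N ^ 2"

definition \<epsilon> :: real where "\<epsilon> = 1 / real a"

definition r :: real where "r = 1 / real N"

text \<open>The sets \<open>{2, i}\<close> with \<open>N \<le> i < 2N\<close>, together with \<open>{N..<2N}\<close>, pin the coordinates of
  the face on \<open>{N..<2N}\<close> to \<open>1/N\<close>. The sets \<open>{N+1..<2N} \<union> {i, j}\<close> pin the coordinates \<open>2N\<close>, \<open>2N+1\<close>,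
  \<open>2N+2\<close> (three of them, so that pairwise sums determine the values) to \<open>1/(2N)\<close>, and bound all later
  ones by \<open>1/(2N)\<close>. Finally \<open>{a<..2a}\<close> and the sets \<open>{2N+1..4N} \<union> {i}\<close> with \<open>4N < i \<le> 2a\<close> pin the
  sum over \<open>{2N+1..4N}\<close> to \<open>1 - \<epsilon>\<close>.\<close>

definition y :: "nat \<Rightarrow> real" where
  "y i = (if i = 2 then 1 - r
     else if N \<le> i \<and> i < 2 * N then r
     else if 2 * N \<le> i \<and> i \<le> 2 * N + 2 then r / 2
     else if 2 * N + 3 \<le> i \<and> i \<le> 4 * N then r / 2 - \<epsilon> / real (2 * N - 2)
     else if 4 * N < i \<and> i \<le> 2 * a then \<epsilon> else 0)"

lemma a_ge: "4 * N \<le> a" "0 < a"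
  using N by (auto simp: a_def power2_eq_square)

lemma eps_pos: "0 < \<epsilon>"
  using a_ge by (simp add: \<epsilon>_def)

lemma eps_eq: "4 * N * \<epsilon> = r / 4"
  using N by (simp add: \<epsilon>_def a_def r_def power2_eq_square field_simps)

lemma eps_small: "\<epsilon> \<le> r / 4"
proof -
  have "1 * \<epsilon> \<le> 4 * N * \<epsilon>"
    by (rule mult_right_mono) (use N eps_pos in auto)
  then show ?thesis using eps_eq by linarith
qed

lemma r_pos: "0 < r"
  using N by (simp add: r_def)

lemma r_le_1: "r \<le> 1"
  using N by (simp add: r_def)

lemma N_r: "real N * r = 1"
  using N by (simp add: r_def)

lemma y_A: "i \<in> {N..<2 * N} \<Longrightarrow> y i = r"
  using N by (auto simp: y_def)

lemma y_C: "i \<in> {2 * N..2 * N + 2} \<Longrightarrow> y i = r / 2"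
  using N by (auto simp: y_def)

lemma y_B: "i \<in> {2 * N + 3..4 * N} \<Longrightarrow> y i = r / 2 - \<epsilon> / real (2 * N - 2)"
  using N by (auto simp: y_def)

lemma y_tail: "i \<in> {4 * N<..2 * a} \<Longrightarrow> y i = \<epsilon>"
  using N by (auto simp: y_def)

lemma y_far: "2 * a < i \<Longrightarrow> y i = 0"
  using N a_ge by (auto simp: y_def)

lemma G_split: "{2 * N + 1..4 * N} = {2 * N + 1, 2 * N + 2} \<union> {2 * N + 3..4 * N}"
  using N by auto

lemma sum_G:
  fixes f :: "nat \<Rightarrow> real"
  shows "sum f {2 * N + 1..4 * N} = f (2 * N + 1) + f (2 * N + 2) + sum f {2 * N + 3..4 * N}"
  unfolding G_split by (subst sum.union_disjoint) auto

lemma sum_B_const: "real (2 * N - 2) * (r / 2) = 1 - r"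
  using N N_r by (simp add: of_nat_diff algebra_simps)

text \<open>With \<open>r / 2\<close> throughout, the \<open>2 * N\<close> entries would add up to
  1; the equal defects on the last \<open>2 * N - 2\<close> of them remove
  \<open>\<epsilon>\<close>.\<close>

lemma sum_y_G: "sum y {2 * N + 1..4 * N} = 1 - \<epsilon>"
proof -
  define q where "q = real (2 * N - 2)"
  have q: "q \<noteq> 0" "q * (r / 2) = 1 - r"
    using N sum_B_const by (simp_all add: q_def)
  have "sum y {2 * N + 3..4 * N} = (\<Sum>i\<in>{2 * N + 3..4 * N}. r / 2 - \<epsilon> / q)"
    by (rule sum.cong) (simp_all only: y_B q_def)
  also have "\<dots> = q * (r / 2 - \<epsilon> / q)"
    unfolding q_def by (simp del: of_nat_diff)
  also have "\<dots> = 1 - r - \<epsilon>"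
    using q by (simp add: right_diff_distrib)
  finally show ?thesis
    unfolding sum_G by (simp add: y_C)
qed

lemma y_B_bounds:
  assumes "i \<in> {2 * N + 3..4 * N}"
  shows "r / 2 - \<epsilon> \<le> y i" "y i \<le> r / 2"
proof -
  have "\<epsilon> / real (2 * N - 2) \<le> \<epsilon> / 1" "0 \<le> \<epsilon> / real (2 * N - 2)"
    by (rule divide_left_mono) (use N eps_pos in auto)
  then show "r / 2 - \<epsilon> \<le> y i" "y i \<le> r / 2"
    using y_B[OF assms] by simp_all
qed

lemma y_G_ge:
  assumes "i \<in> {2 * N + 1..4 * N}"
  shows "r / 2 - \<epsilon> \<le> y i"
  using assms y_B_bounds(1)[of i] y_C[of i] eps_pos by (cases "2 * N + 3 \<le> i") auto

lemma y_nonneg: "0 \<le> y i"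
proof -
  have "\<epsilon> / real (2 * N - 2) \<le> \<epsilon> / 1"
    by (rule divide_left_mono) (use N eps_pos in auto)
  then have "0 \<le> r / 2 - \<epsilon> / real (2 * N - 2)"
    using eps_small r_pos by simp
  then show ?thesis
    using eps_pos r_pos r_le_1 unfolding y_def by (simp del: of_nat_diff)
qed

lemma y_le:
  assumes "2 * N \<le> i"
  shows "y i \<le> r / 2"
proof (cases "i \<in> {2 * N + 3..4 * N}")
  case True
  then show ?thesis by (rule y_B_bounds(2))
next
  case False
  then show ?thesis using N assms eps_pos eps_small r_pos by (auto simp: y_def)
qed

lemma y_le': "3 \<le> i \<Longrightarrow> y i \<le> r"
  using y_le[of i] r_pos by (cases "2 * N \<le> i") (auto simp: y_def)

lemma y_le_eps: "4 * N < i \<Longrightarrow> y i \<le> \<epsilon>"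
  using N eps_pos by (auto simp: y_def)

section \<open>The norm of \<open>y\<close>\<close>

text \<open>Majorises, on the coordinates from \<open>N\<close> on, every vector in the face of \<open>y\<close>.\<close>

definition d :: "nat \<Rightarrow> real" where
  "d i = (if i < 2 * N then r else r / 2)"

text \<open>Each element costs \<open>r / 2\<close>, and again \<open>r / 2\<close> if below
  \<open>2 * N\<close>. There are at most \<open>m\<close> elements, at most
  \<open>2 * N - m\<close> of them below \<open>2 * N\<close>: in total
  \<open>2 * N * (r / 2) = 1\<close>.\<close>

lemma sum_d_le:
  assumes "finite F" "F \<subseteq> {m..}" "card F \<le> m" "m \<le> 2 * N"
  shows "sum d F \<le> 1"
proof -
  let ?A = "F \<inter> {i. i < 2 * N}"
  have "sum d F = (\<Sum>i\<in>F. r / 2 + (if i < 2 * N then r / 2 else 0))"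
    by (rule sum.cong) (simp_all add: d_def)
  also have "\<dots> = (card F + card ?A) * (r / 2)"
    using assms(1) by (simp add: sum.distrib sum.If_cases algebra_simps)
  also have "\<dots> \<le> (2 * N) * (r / 2)"
  proof (rule mult_right_mono)
    have "card ?A \<le> card {m..<2 * N}"
      by (rule card_mono) (use assms in auto)
    then show "real (card F + card ?A) \<le> real (2 * N)" using assms by simp
  qed (use r_pos in simp)
  also have "\<dots> = 1" using N_r by simp
  finally show ?thesis .
qed

text \<open>Omitting \<open>c\<close> loses at least \<open>r / 2 - \<epsilon>\<close> from the
  block sum, while the tail returns at most \<open>4 * N * \<epsilon> = r / 4\<close>. It is applied
  to \<open>y\<close> and to vectors of its face.\<close>

lemma sum_missing_le:
  fixes f :: "nat \<Rightarrow> real"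
  assumes F: "finite F" "F \<subseteq> {2 * N + 1..}" "card F \<le> 4 * N"
    and c: "c \<in> {2 * N + 1..4 * N}" "c \<notin> F"
    and G: "(\<Sum>i\<in>{2 * N + 1..4 * N}. \<bar>f i\<bar>) = 1 - \<epsilon>"
    and fc: "r / 2 - \<epsilon> \<le> \<bar>f c\<bar>"
    and tail: "\<And>i. 4 * N < i \<Longrightarrow> \<bar>f i\<bar> \<le> \<epsilon>"
  shows "(\<Sum>i\<in>F. \<bar>f i\<bar>) \<le> 1 - r / 4"
proof -
  let ?G = "{2 * N + 1..4 * N}"
  have "(\<Sum>i\<in>F. \<bar>f i\<bar>) = (\<Sum>i\<in>F \<inter> ?G. \<bar>f i\<bar>) + (\<Sum>i\<in>F - ?G. \<bar>f i\<bar>)"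
    by (rule sum.Int_Diff) fact
  also have "(\<Sum>i\<in>F \<inter> ?G. \<bar>f i\<bar>) \<le> (\<Sum>i\<in>?G - {c}. \<bar>f i\<bar>)"
    by (rule sum_mono2) (use c in auto)
  also have "\<dots> = 1 - \<epsilon> - \<bar>f c\<bar>"
    using c G by (simp add: sum_diff1)
  also have "(\<Sum>i\<in>F - ?G. \<bar>f i\<bar>) \<le> card (F - ?G) * \<epsilon>"
    by (rule sum_bounded_above, rule tail) (use F(2) in fastforce)
  also have "\<dots> \<le> 4 * N * \<epsilon>"
  proof (rule mult_right_mono)
    have "card (F - ?G) \<le> card F" by (rule card_mono) (use F in auto)
    then show "real (card (F - ?G)) \<le> 4 * N" using F(3) by simp
  qed (use eps_pos in simp)
  finally show ?thesis using fc eps_eq by simp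
qed

lemma sum_y_le:
  assumes "admissible F"
  shows "sum y F \<le> 1"
proof (cases "F = {}")
  case False
  with assms obtain m where m: "m \<in> F" "F \<subseteq> {m..}" "card F \<le> m" "1 \<le> m"
    by (rule admissibleE)
  have fin: "finite F" using assms by (rule admissible_finite)
  have mF: "m \<le> i" if "i \<in> F" for i using m(2) that by auto
  consider "m = 1" | "m = 2" | "3 \<le> m" "m < N" | "N \<le> m" "m \<le> 2 * N"
    | "2 * N < m" "m \<le> 4 * N" | "4 * N < m"
    using m(4) by linarith
  then show ?thesis
  proof cases
    case 1
    then have "F = {1}"
      using m fin by (metis One_nat_def card_1_singletonE card_gt_0_iff empty_iff
          le_antisym less_eq_Suc_le singletonD)
    then show ?thesis using N by (simp add: y_def)
  next
    case 2
    have "sum y F = y 2 + sum y (F - {2})"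
      using m(1) 2 fin by (simp add: sum.remove)
    also have "sum y (F - {2}) \<le> card (F - {2}) * (r)"
      by (rule sum_bounded_above, rule y_le') (use mF 2 in force)
    also have "\<dots> \<le> 1 * (r)"
      by (rule mult_right_mono) (use m 2 fin r_pos in \<open>auto simp: card_Diff_singleton\<close>)
    finally show ?thesis by (simp add: y_def)
  next
    case 3
    have "sum y F \<le> card F * (r)"
      by (rule sum_bounded_above, rule y_le') (use mF 3 in fastforce)
    also have "\<dots> \<le> N * (r)"
      by (rule mult_right_mono) (use m 3 r_pos in auto)
    finally show ?thesis using N_r by simp
  next
    case 4
    have "sum y F \<le> sum d F"
    proof (rule sum_mono)
      fix i assume "i \<in> F"
      then show "y i \<le> d i" using mF[of i] 4 N y_le[of i] y_le'[of i] by (auto simp: d_def)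
    qed
    also have "\<dots> \<le> 1" by (rule sum_d_le) (use fin m 4 in auto)
    finally show ?thesis .
  next
    case 5
    show ?thesis
    proof (cases "{2 * N + 1..4 * N} \<subseteq> F")
      case True
      \<comment> \<open>The block has \<open>2 * N\<close> elements and the minimum is
        \<open>2 * N + 1\<close>, so \<open>F\<close> has room for one tail element, of height at
        most \<open>\<epsilon>\<close>.\<close>
      then have "2 * N + 1 \<in> F" using N by auto
      then have "m = 2 * N + 1" using mF 5 by force
      moreover have "card F = card (F - {2 * N + 1..4 * N}) + card {2 * N + 1..4 * N}"
        using True fin card_mono[OF fin True] by (simp add: card_Diff_subset)
      ultimately have c: "card (F - {2 * N + 1..4 * N}) \<le> 1"
        using m(3) by simp
      have "sum y F = sum y (F - {2 * N + 1..4 * N}) + (1 - \<epsilon>)"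
        using sum.subset_diff[OF True fin, of y] sum_y_G by simp
      also have "sum y (F - {2 * N + 1..4 * N}) \<le> card (F - {2 * N + 1..4 * N}) * \<epsilon>"
        by (rule sum_bounded_above, rule y_le_eps) (use mF 5 in fastforce)
      also have "\<dots> \<le> 1 * \<epsilon>"
        by (rule mult_right_mono) (use c eps_pos in auto)
      finally show ?thesis by simp
    next
      case False
      then obtain c where c: "c \<in> {2 * N + 1..4 * N}" "c \<notin> F" by blast
      have "(\<Sum>i\<in>F. \<bar>y i\<bar>) \<le> 1 - r / 4"
        by (rule sum_missing_le[OF fin _ _ c])
          (use m 5 sum_y_G y_nonneg y_le_eps y_G_ge[OF c(1)] in auto)
      then show ?thesis using y_nonneg r_pos by simp
    qed
  next
    case 6
    have "sum y F = sum y (F \<inter> {..2 * a})"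
      by (rule sum.mono_neutral_right) (use fin y_far in \<open>auto simp flip: not_less\<close>)
    also have "\<dots> \<le> card (F \<inter> {..2 * a}) * \<epsilon>"
      by (rule sum_bounded_above, rule y_le_eps) (use mF 6 in fastforce)
    also have "\<dots> \<le> a * \<epsilon>"
    proof (rule mult_right_mono)
      \<comment> \<open>The bounds \<open>m\<close> and \<open>2 * a + 1 - m\<close> on this
        cardinality cannot both exceed \<open>a\<close>.\<close>
      have "card (F \<inter> {..2 * a}) \<le> card F"
        by (rule card_mono) (use fin in auto)
      moreover have "card (F \<inter> {..2 * a}) \<le> card {m..2 * a}"
        by (rule card_mono) (use m in auto)
      ultimately show "real (card (F \<inter> {..2 * a})) \<le> a"
        using m(3) by simp
    qed (use eps_pos in simp)
    finally show ?thesis using a_ge by (simp add: \<epsilon>_def)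
  qed
qed simp

lemma y_c00: "y \<in> c00"
proof -
  have "{i. y i \<noteq> 0} \<subseteq> {..2 * a}" by (auto simp: y_far simp flip: not_less)
  then have "finite {i. y i \<noteq> 0}" by (rule finite_subset) simp
  moreover have "y 0 = 0" using N by (simp add: y_def)
  ultimately show ?thesis by (simp add: c00_def)
qed

definition u :: schreier where "u = Abs_schreier y"

lemma coord_u: "coord u = y"
  unfolding u_def by (rule Abs_schreier_inverse) (use c00_subset_schreier_seqs y_c00 in auto)

lemma u_Ba: "u \<in> Ba"
  using schreier_norm_le[of y 1] sum_y_le y_nonneg
  by (simp add: norm_schreier_def coord_u)

section \<open>Coordinates of vectors in the face of \<open>y\<close>\<close>

text \<open>The \<open>N - 1\<close> block elements plus \<open>i\<close> and \<open>j\<close> just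
  reach the permitted size \<open>N + 1\<close>.\<close>

lemma
  assumes ij: "2 * N \<le> i" "2 * N \<le> j" "i \<noteq> j"
  shows pair_admissible: "admissible ({N + 1..<2 * N} \<union> {i, j})"
    and sum_pair: "\<And>f. sum f ({N + 1..<2 * N} \<union> {i, j}) = sum f {N + 1..<2 * N} + (f i + f j :: real)"
proof -
  have d: "{N + 1..<2 * N} \<inter> {i, j} = {}" using ij by auto
  show s: "sum f ({N + 1..<2 * N} \<union> {i, j}) = sum f {N + 1..<2 * N} + (f i + f j)"
    for f :: "nat \<Rightarrow> real"
    using d ij by (simp add: sum.union_disjoint)
  have "card ({N + 1..<2 * N} \<union> {i, j}) \<le> N + 1"
    using N ij d by (subst card_Un_disjoint) auto
  then show "admissible ({N + 1..<2 * N} \<union> {i, j})"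
    by (intro admissibleI[of _ "N + 1"]) (use ij in auto)
qed

context
  fixes v assumes v: "v \<in> norming_face y"
begin

lemma face_A:
  assumes "i \<in> {N..<2 * N}"
  shows "coord v i = r"
proof -
  \<comment> \<open>The pairs \<open>{2, j}\<close> make all block coordinates equal; the block sum
    1 then fixes their common value.\<close>
  have *: "coord v j = 1 - coord v 2" if "j \<in> {N..<2 * N}" for j
  proof -
    have "j \<noteq> 2" using that N by auto
    then have "sum (coord v) {2, j} = 1"
      by (intro norming_face_sum[OF v] admissibleI[of _ 2])
        (use that N y_A[OF that] in \<open>auto simp: y_def\<close>)
    then show ?thesis using \<open>j \<noteq> 2\<close> by simp
  qed
  have "sum (coord v) {N..<2 * N} = 1"
    by (intro norming_face_sum[OF v] admissibleI[of _ N]) (use N N_r y_A in auto)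
  then have "N * (1 - coord v 2) = 1" by (simp add: *)
  then have "1 - coord v 2 = r" using N by (simp add: r_def eq_divide_eq mult.commute)
  then show ?thesis using *[OF assms] by simp
qed

lemma face_pair_eq:
  assumes "i \<in> {2 * N..2 * N + 2}" "j \<in> {2 * N..2 * N + 2}" "i \<noteq> j"
  shows "coord v i + coord v j = r"
proof -
  have ij: "2 * N \<le> i" "2 * N \<le> j" "i \<noteq> j" using assms by auto
  have "sum y {N + 1..<2 * N} = (N - 1) * r" "sum (coord v) {N + 1..<2 * N} = (N - 1) * r"
    using N by (simp_all add: y_A face_A of_nat_diff)
  moreover have "real (N - 1) * r = 1 - r" using N N_r by (simp add: of_nat_diff algebra_simps)
  ultimately show ?thesis
    using norming_face_sum[OF v pair_admissible[OF ij]] y_C[OF assms(1)] y_C[OF assms(2)]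
    unfolding sum_pair[OF ij] by simp
qed

lemma face_C:
  assumes "i \<in> {2 * N..2 * N + 2}"
  shows "coord v i = r / 2"
proof -
  have "i = 2 * N \<or> i = 2 * N + 1 \<or> i = 2 * N + 2" using assms by auto
  then show ?thesis
    using face_pair_eq[of "2 * N" "2 * N + 1"] face_pair_eq[of "2 * N" "2 * N + 2"]
      face_pair_eq[of "2 * N + 1" "2 * N + 2"] by auto
qed

lemma face_le:
  assumes "2 * N \<le> i"
  shows "\<bar>coord v i\<bar> \<le> r / 2"
proof -
  \<comment> \<open>A partner with known value \<open>r / 2\<close>: the rest of the admissible set
    then leaves at most \<open>r / 2\<close> for \<open>i\<close>.\<close>
  obtain j where j: "j \<in> {2 * N..2 * N + 2}" "i \<noteq> j"
    by (cases "i = 2 * N") (force intro: that[of "2 * N"] that[of "2 * N + 1"])+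
  then have ij: "2 * N \<le> i" "2 * N \<le> j" "i \<noteq> j" using assms by auto
  have "(\<Sum>i\<in>{N + 1..<2 * N}. \<bar>coord v i\<bar>) = (N - 1) * r"
    using N r_pos by (simp add: face_A of_nat_diff)
  moreover have "real (N - 1) * r = 1 - r" using N N_r by (simp add: of_nat_diff algebra_simps)
  ultimately show ?thesis
    using norming_face_abs_le[OF v pair_admissible[OF ij]] face_C[OF j(1)]
    unfolding sum_pair[OF ij] by simp
qed

lemma insert_G_admissible: "4 * N < i \<Longrightarrow> admissible (insert i {2 * N + 1..4 * N})"
  by (intro admissibleI[of _ "2 * N + 1"]) auto

lemma insert_G_norming:
  "i \<in> {4 * N<..2 * a} \<Longrightarrow> sum y (insert i {2 * N + 1..4 * N}) = 1"
  using sum_y_G y_tail[of i] by simp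

text \<open>Every tail coordinate up to \<open>2 * a\<close> equals the complement
  \<open>1 - ?s\<close>, and \<open>a\<close> of them sum to 1.\<close>

lemma face_sum_G: "sum (coord v) {2 * N + 1..4 * N} = 1 - \<epsilon>"
proof -
  let ?s = "sum (coord v) {2 * N + 1..4 * N}"
  have tail: "coord v i = 1 - ?s" if "i \<in> {4 * N<..2 * a}" for i
    using norming_face_sum[OF v insert_G_admissible insert_G_norming, of i] that by simp
  have "sum (coord v) {a<..2 * a} = 1"
    by (intro norming_face_sum[OF v] admissibleI[of _ a])
      (use a_ge y_tail in \<open>auto simp: \<epsilon>_def\<close>)
  moreover have "sum (coord v) {a<..2 * a} = a * (1 - ?s)"
    using a_ge tail by simp
  ultimately show ?thesis using a_ge by (simp add: \<epsilon>_def field_simps)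
qed

lemma face_G_nonneg: "i \<in> {2 * N + 1..4 * N} \<Longrightarrow> 0 \<le> coord v i"
  by (rule norming_face_nonneg[OF v insert_G_admissible insert_G_norming, of "4 * N + 1"])
    (use a_ge N in auto)

lemma face_sum_G_abs: "(\<Sum>i\<in>{2 * N + 1..4 * N}. \<bar>coord v i\<bar>) = 1 - \<epsilon>"
  using face_sum_G face_G_nonneg by simp

lemma face_tail: "4 * N < i \<Longrightarrow> \<bar>coord v i\<bar> \<le> \<epsilon>"
  using norming_face_abs_le[OF v insert_G_admissible, of i] face_sum_G_abs by simp

text \<open>These defects are the vector \<open>g\<close> of the simplex picture.\<close>

lemma face_sum_defect: "(\<Sum>i\<in>{2 * N + 3..4 * N}. r / 2 - coord v i) = \<epsilon>"
proof -
  have "sum (coord v) {2 * N + 3..4 * N} = 1 - \<epsilon> - r"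
    using face_sum_G face_C[of "2 * N + 1"] face_C[of "2 * N + 2"] unfolding sum_G by simp
  moreover have "(\<Sum>i\<in>{2 * N + 3..4 * N}. r / 2) = 1 - r"
    using sum_B_const by simp
  ultimately show ?thesis unfolding sum_subtractf by linarith
qed

lemma face_B_ge:
  assumes "i \<in> {2 * N + 3..4 * N}"
  shows "r / 2 - \<epsilon> \<le> coord v i"
proof -
  have "r / 2 - coord v i \<le> (\<Sum>i\<in>{2 * N + 3..4 * N}. r / 2 - coord v i)"
    by (rule member_le_sum[OF assms]) (use face_le[THEN abs_le_D1] in auto)
  then show ?thesis by (simp add: face_sum_defect)
qed

text \<open>For \<open>t > 0\<close> this says that a set separating \<open>b\<close> from
  \<open>c\<close> is not norming and leaves room to raise the entry at \<open>b\<close> by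
  \<open>t\<close>. The cases follow the minimum \<open>m\<close> of \<open>F\<close>.\<close>

lemma face_slack:
  assumes F: "admissible F" and b: "b \<in> {2 * N + 3..4 * N}" "b \<in> F"
    and c: "c \<in> {2 * N + 3..4 * N}" "c \<notin> F"
    and t: "t \<le> r / 4" "t \<le> r / 2 - coord v b"
  shows "(\<Sum>i\<in>F. \<bar>coord v i\<bar>) + t \<le> 1"
proof -
  have fin: "finite F" using F by (rule admissible_finite)
  obtain m where m: "m \<in> F" "F \<subseteq> {m..}" "card F \<le> m" "1 \<le> m"
    using admissibleE[OF F] b by blast
  have rem: "sum f F = f b + sum f (F - {b})" for f :: "nat \<Rightarrow> real"
    using fin b by (simp add: sum.remove)
  consider "m < N" | "N \<le> m" "m \<le> 2 * N" | "2 * N < m" by linarith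
  then show ?thesis
  proof cases
    case 1
    \<comment> \<open>Trading \<open>b\<close> for an unused coordinate of the larger block \<open>{N..<2N}\<close> gains at least \<open>r / 2\<close>.\<close>
    have "\<not> {N..<2 * N} \<subseteq> F"
      using card_mono[OF fin, of "{N..<2 * N}"] m(3) 1 by auto
    then obtain i where i: "i \<in> {N..<2 * N}" "i \<notin> F" by blast
    have "admissible (insert i (F - {b}))"
      using m 1 i b fin by (intro admissibleI[of _ m]) (auto simp: card_Suc_Diff1 card_Diff_singleton)
    then have "r + (\<Sum>i\<in>F - {b}. \<bar>coord v i\<bar>) \<le> 1"
      using norming_face_abs_le[OF v] face_A[OF i(1)] i fin by fastforce
    then show ?thesis
      using face_le[of b] b rem[of "\<lambda>i. \<bar>coord v i\<bar>"] t(1) by simp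
  next
    case 2
    \<comment> \<open>The majorant \<open>d\<close> sums to at most 1 and exceeds \<open>v\<close>
      at \<open>b\<close> by the defect there, which is the required slack.\<close>
    have "(\<Sum>i\<in>F - {b}. \<bar>coord v i\<bar>) \<le> sum d (F - {b})"
    proof (rule sum_mono)
      fix i assume "i \<in> F - {b}"
      then have "N \<le> i" using m(2) 2 by auto
      then show "\<bar>coord v i\<bar> \<le> d i"
        using face_le[of i] face_A[of i] r_pos by (auto simp: d_def)
    qed
    moreover have "d b = r / 2" using b by (simp add: d_def)
    moreover have "sum d F \<le> 1" by (rule sum_d_le) (use fin m 2 in auto)
    ultimately show ?thesis
      using rem[of d] rem[of "\<lambda>i. \<bar>coord v i\<bar>"] t(2) face_G_nonneg[of b] b by simp
  next
    case 3
    \<comment> \<open>Here the slack comes from the missing coordinate \<open>c\<close>.\<close>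
    have "(\<Sum>i\<in>F. \<bar>coord v i\<bar>) \<le> 1 - r / 4"
      by (rule sum_missing_le[OF fin _ _ _ c(2)])
        (use m 3 b c face_sum_G_abs face_tail face_B_ge[OF c(1)] in auto)
    then show ?thesis using t(1) by simp
  qed
qed

end

section \<open>Extreme points of the face and the bound on \<open>l\<close>\<close>

text \<open>The entries at \<open>b\<close> and \<open>c\<close> stay nonnegative, so absolute sums
  change linearly: the changes cancel if \<open>F\<close> contains both points, and
  \<open>face_slack\<close> absorbs them if it contains one.\<close>

lemma norm_perturb_le:
  assumes v: "v \<in> norming_face y" and b: "b \<in> {2 * N + 3..4 * N}" "c \<in> {2 * N + 3..4 * N}" "b \<noteq> c"
    and t: "\<bar>t\<bar> \<le> r / 4" "\<bar>t\<bar> \<le> r / 2 - coord v b" "\<bar>t\<bar> \<le> r / 2 - coord v c"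
    and w: "coord w = (\<lambda>i. coord v i + (if i = b then t else if i = c then - t else 0))"
  shows "norm w \<le> 1"
  unfolding norm_schreier_def
proof (rule schreier_norm_le)
  fix F assume F: "admissible F"
  have fin: "finite F" using F by (rule admissible_finite)
  note ge = face_B_ge[OF v b(1)] face_B_ge[OF v b(2)]
  have pos: "\<bar>t\<bar> \<le> coord v b" "\<bar>t\<bar> \<le> coord v c"
    using ge eps_small t(1) by simp_all
  have "\<bar>coord w i\<bar> = \<bar>coord v i\<bar> + (if i = b then t else 0) + (if i = c then - t else 0)" for i
    using pos b(3) by (auto simp: w)
  then have "(\<Sum>i\<in>F. \<bar>coord w i\<bar>) =
      (\<Sum>i\<in>F. \<bar>coord v i\<bar>) + (if b \<in> F then t else 0) + (if c \<in> F then - t else 0)"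
    using fin by (simp add: sum.distrib)
  then show "(\<Sum>i\<in>F. \<bar>coord w i\<bar>) \<le> 1"
    using norming_face_abs_le[OF v F] face_slack[OF v F b(1) _ b(2), of "\<bar>t\<bar>"]
      face_slack[OF v F b(2) _ b(1), of "\<bar>t\<bar>"] t
    by (cases "b \<in> F"; cases "c \<in> F") auto
qed

lemma extreme_defect_unique:
  assumes v: "v \<in> norming_face y" and ex: "v extreme_point_of Ba"
    and b: "b \<in> {2 * N + 3..4 * N}" "c \<in> {2 * N + 3..4 * N}"
    and pos: "coord v b < r / 2" "coord v c < r / 2"
  shows "b = c"
proof (rule ccontr)
  assume bc: "b \<noteq> c"
  define t where "t = min (r / 4) (min (r / 2 - coord v b) (r / 2 - coord v c))"
  have t: "0 < t" "t \<le> r / 4" "t \<le> r / 2 - coord v b" "t \<le> r / 2 - coord v c"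
    using pos r_pos unfolding t_def by linarith+
  define f where "f = (\<lambda>i. if i = b then t else if i = c then - t else 0)"
  have "f \<in> c00"
    using b by (auto simp: f_def c00_def intro: finite_subset[where B = "{b, c}"])
  then obtain h where h: "coord h = f" using c00_subset_range_coord by (metis imageE subsetD)
  have "norm (v + h) \<le> 1"
    by (rule norm_perturb_le[OF v b bc, of t]) (use t in \<open>auto simp: coord_add h f_def\<close>)
  moreover have "norm (v - h) \<le> 1"
    by (rule norm_perturb_le[OF v b bc, of "- t"]) (use t in \<open>auto simp: coord_minus h f_def\<close>)
  ultimately have "h = 0" by (rule extreme_point_perturb[OF ex])
  then have "f b = 0" by (simp flip: h add: coord_zero)
  then show False using t(1) by (simp add: f_def)
qed

lemma lambda_triple_le:
  assumes t: "lambda_triple e z l u"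
  shows "l \<le> 1 / real (2 * N - 2)"
proof -
  let ?B = "{2 * N + 3..4 * N}"
  have ex: "e extreme_point_of Ba" and l: "0 < l" "l \<le> 1" and u: "u = l *\<^sub>R e + (1 - l) *\<^sub>R z"
    using t by (auto simp: lambda_triple_def)
  have e: "e \<in> norming_face y" and z: "l < 1 \<Longrightarrow> z \<in> norming_face y"
    using lambda_triple_norming_face[OF t] by (simp_all add: coord_u)
  let ?g = "\<lambda>i. r / 2 - coord e i"
  have "\<exists>b\<in>?B. 0 < ?g b"
  proof (rule ccontr)
    assume "\<not> ?thesis"
    then have "sum ?g ?B \<le> 0" by (intro sum_nonpos) force
    then show False using face_sum_defect[OF e] eps_pos by simp
  qed
  then obtain b where b: "b \<in> ?B" "0 < ?g b" by blast
  \<comment> \<open>An extreme point has only one positive defect, so \<open>b\<close> carries the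
    whole total \<open>\<epsilon>\<close>.\<close>
  have "?g i = 0" if "i \<in> ?B - {b}" for i
    using extreme_defect_unique[OF e ex, of i b] face_le[OF e, of i] that b by fastforce
  then have "?g b = sum ?g ?B" by (simp add: sum.remove[OF _ b(1)])
  then have gb: "coord e b = r / 2 - \<epsilon>" by (simp add: face_sum_defect[OF e])
  \<comment> \<open>For \<open>l = 1\<close> the point \<open>z\<close> is uncontrolled, but its
    weight vanishes.\<close>
  have zb: "(1 - l) * coord z b \<le> (1 - l) * (r / 2)"
  proof (cases "l < 1")
    case True
    then show ?thesis using face_le[OF z, of b] b l by (intro mult_left_mono) auto
  qed (use l in simp)
  \<comment> \<open>Compare defects at \<open>b\<close>: that of \<open>u\<close> is an equal share
    of \<open>\<epsilon>\<close>, while \<open>e\<close> alone contributes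
    \<open>l * \<epsilon>\<close>.\<close>
  have "r / 2 - \<epsilon> / real (2 * N - 2) = l * coord e b + (1 - l) * coord z b"
    using y_B[OF b(1)] coord_u by (simp add: u coord_add coord_scaleR flip: coord_u)
  also have "\<dots> \<le> r / 2 - l * \<epsilon>"
    using zb by (simp add: gb algebra_simps)
  finally have "l * \<epsilon> \<le> (1 / real (2 * N - 2)) * \<epsilon>" by simp
  then show ?thesis using eps_pos by (rule mult_right_le_imp_le)
qed

lemma lambda_fun_le: "lambda_fun u \<le> 1 / real (2 * N - 2)"
  unfolding lambda_fun_def
  by (rule cSup_least) (use N lambda_triple_le in auto)

end

theorem theorem1p1:
  shows "\<not> uniform_lambda_property TYPE(schreier)"
proof
  assume "uniform_lambda_property TYPE(schreier)"
  then obtain l0 where l0: "0 < l0" "\<And>v :: schreier. v \<in> Ba \<Longrightarrow> l0 \<le> lambda_fun v"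
    unfolding uniform_lambda_property_def by blast
  obtain k :: nat where k: "1 / l0 < k" using reals_Archimedean2 by blast
  \<comment> \<open>The shift secures \<open>3 \<le> N\<close>, and \<open>2 * (k + 3) - 2\<close>
    still exceeds \<open>k\<close>, hence \<open>1 / l0\<close>.\<close>
  interpret slow_vector "k + 3" by unfold_locales simp
  have k0: "0 < real k" using k l0(1) by (meson divide_pos_pos less_trans zero_less_one)
  have "l0 \<le> 1 / real (2 * (k + 3) - 2)"
    using l0(2)[OF u_Ba] lambda_fun_le by (rule order_trans)
  also have "\<dots> \<le> 1 / k" using k0 by (intro divide_left_mono) auto
  also have "\<dots> < l0" using k k0 l0(1) by (simp add: field_simps)
  finally show False by simp
qed

end
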